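(* Let $T$ be a pr-tree and let $T'$ be a pr-tree obtained from $T$ by one transposition. Then $T$ and $T'$ have different parities: exactly one of $T$, $T'$ is even.
   Context: A pr-tree (plane rooted tree) is a finite tree embedded in the plane with a chosen root vertex and a chosen marked edge incident to the root; it is drawn growing downwards from the root with the marked edge leftmost. Equivalently, it is a rooted tree in which the children of every vertex are linearly ordered from left to right. The walk around a pr-tree starts at the root and traverses each edge twice, once in each direction, visiting the children of each vertex from left to right (depth-first, the tree always on the left of the walker), ending at the root. Bracket code: write an opening bracket when a vertex is met for the first time in the walk and a closing bracket when it is met for the last time. Thus, recursively, the code of a pr-tree whose root has pr-subtrees $T_1,\dots,T_s$ (left to right) is $(\,c(T_1)\cdots c(T_s)\,)$, and the one-vertex tree has code $()$. An inversion in a bracket code is a pair consisting of a closing bracket and an opening bracket, not necessarily adjacent, such that the closing bracket occurs before the opening bracket. A pr-tree is even if the number of inversions in its bracket code is even, and odd otherwise; this is its parity. Transposition: let $A,B,C$ be three vertices of a pr-tree such that $B$ has degree one and the walk meets vertices consecutively in the sequence $A,B,A,C$. The transposition moves the vertex $B$ with its attached edge along the single edge $AC$ from $A$ to $C$, on the side of the edge $AC$ along which the walk goes. Explicitly, $B$ is a childless child of $A$, and there are two cases: (i) if $C$ is the child of $A$ immediately following $B$ in the left-to-right order, then $B$ is removed from $A$ and becomes the first (leftmost) child of $C$; (ii) if $B$ is the last (rightmost) child of $A$ and $C$ is the parent of $A$, then $B$ is removed from $A$ and becomes a child of $C$ placed immediately after (to the right of) $A$. Everything else is unchanged. *)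

theory Defs
  imports Main
begin

text \<open>
  A pr-tree (plane rooted tree): a vertex with the left-to-right list of the subtrees at its
  children. Vertices carry no labels.
\<close>

datatype prtree = Node (children: "prtree list")

datatype bracket = Opening | Closing

fun bracket_code :: "prtree \<Rightarrow> bracket list" where
  "bracket_code (Node ts) = Opening # concat (map bracket_code ts) @ [Closing]"

text \<open>Brackets are identified by their positions in the word.\<close>

definition inversions :: "bracket list \<Rightarrow> (nat \<times> nat) set" where
  "inversions w = {(i, j). i < j \<and> j < length w \<and> w ! i = Closing \<and> w ! j = Opening}"

definition even_prtree :: "prtree \<Rightarrow> bool" where
  "even_prtree T \<longleftrightarrow> even (card (inversions (bracket_code T)))"

text \<open>
  \<open>transposition T T'\<close>: \<open>T'\<close> arises from \<open>T\<close> by one transposition, in which the leaf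
  \<open>B = Node []\<close> moves from \<open>A\<close> to \<open>C\<close>. The first two rules describe the move at the top of the
  tree: in \<open>next_sibling\<close> the displayed root is \<open>A\<close> and \<open>C\<close>, with children \<open>cs\<close>, is the sibling
  that immediately follows \<open>B\<close>; in \<open>parent\<close> the displayed root is \<open>C\<close>, and \<open>B\<close> is the last child
  of its child \<open>A\<close>. The rule \<open>subtree\<close> lets the move happen anywhere inside the tree.
\<close>

inductive transposition :: "prtree \<Rightarrow> prtree \<Rightarrow> bool" where
  next_sibling:
    "transposition (Node (ls @ [Node [], Node cs] @ rs)) (Node (ls @ [Node (Node [] # cs)] @ rs))"
| parent:
    "transposition (Node (ls @ [Node (as @ [Node []])] @ rs)) (Node (ls @ [Node as, Node []] @ rs))"
| subtree:
    "transposition t t' \<Longrightarrow> transposition (Node (ls @ [t] @ rs)) (Node (ls @ [t'] @ rs))"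

end

theory Submission imports Defs begin

text \<open>The leaf \<open>B\<close> contributes an adjacent block \<open>()\<close>, which a
  transposition carries past one bracket: the opening one of \<open>C\<close>, turning
  \<open>()(\<close> into \<open>(()\<close>, or the closing one of \<open>A\<close>, turning
  \<open>())\<close> into \<open>)()\<close>. As words, each change is one swap of adjacent unlike
  brackets (\<open>bracket_code_transposition\<close>). Such a swap alters the order of that pair
  only, so the inversion count changes by one (\<open>card_inversions_swap\<close>).\<close>

text \<open>
  A transposition exchanges two adjacent, different brackets of the bracket code, so it changes
  the number of inversions by exactly one.
\<close>

lemma finite_inversions: "finite (inversions w)"
  by (rule finite_subset[of _ "{..<length w} \<times> {..<length w}"]) (auto simp: inversions_def)

lemma inversions_Cons:
  "inversions (x # w) =
    (\<lambda>j. (0, Suc j)) ` {j. j < length w \<and> x = Closing \<and> w ! j = Opening} \<union>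
    map_prod Suc Suc ` inversions w"
  (is "_ = ?R")
proof (rule set_eqI, rule prod.induct)
  fix i j
  show "(i, j) \<in> inversions (x # w) \<longleftrightarrow> (i, j) \<in> ?R"
    by (cases i; cases j) (auto simp: inversions_def)
qed

text \<open>Position 0 can only be the closing end of an inversion, and then every later opening
  bracket is a partner.\<close>

lemma card_inversions_Cons:
  "card (inversions (x # w)) =
    (if x = Closing then length (filter ((=) Opening) w) else 0) + card (inversions w)"
proof -
  have "card (inversions (x # w)) =
      card ((\<lambda>j. (0::nat, Suc j)) ` {j. j < length w \<and> x = Closing \<and> w ! j = Opening}) +
      card (map_prod Suc Suc ` inversions w)"
    unfolding inversions_Cons
    by (rule card_Un_disjoint) (auto simp: finite_inversions)
  also have "card (map_prod Suc Suc ` inversions w) = card (inversions w)"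
    by (rule card_image) (auto simp: inj_on_def)
  also have "card ((\<lambda>j. (0::nat, Suc j)) ` {j. j < length w \<and> x = Closing \<and> w ! j = Opening}) =
      card {j. j < length w \<and> x = Closing \<and> w ! j = Opening}"
    by (rule card_image) (simp add: inj_on_def)
  finally show ?thesis
    by (simp add: length_filter_conv_card eq_commute[of Opening])
qed

text \<open>Each bracket of \<open>u\<close> sees equally many opening brackets after it on both
  sides, so induction reduces the claim to empty \<open>u\<close>.\<close>

lemma card_inversions_swap:
  "card (inversions (u @ [Closing, Opening] @ v)) =
    Suc (card (inversions (u @ [Opening, Closing] @ v)))"
  by (induction u) (simp_all add: card_inversions_Cons)

lemma bracket_code_transposition:
  assumes "transposition T T'"
  shows "\<exists>u v x y. x \<noteq> y \<and> bracket_code T = u @ [x, y] @ v \<and> bracket_code T' = u @ [y, x] @ v"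
  using assms
proof induction
  case (next_sibling ls cs rs)
  show ?case
    \<comment> \<open>The swapped pair is the closing bracket of \<open>B\<close> and the opening
      bracket of \<open>C\<close>.\<close>
    by (rule exI[of _ "Opening # concat (map bracket_code ls) @ [Opening]"],
        rule exI[of _ "concat (map bracket_code cs) @ [Closing] @
          concat (map bracket_code rs) @ [Closing]"],
        rule exI[of _ Closing], rule exI[of _ Opening]) simp
next
  case (parent ls as rs)
  show ?case
    \<comment> \<open>Here \<open>B\<close>'s own two brackets are swapped: the closing one now
      closes \<open>A\<close>, and the old closing bracket of \<open>A\<close>, heading the suffix,
      closes \<open>B\<close>.\<close>
    by (rule exI[of _ "Opening # concat (map bracket_code ls) @ [Opening] @
          concat (map bracket_code as)"],
        rule exI[of _ "[Closing] @ concat (map bracket_code rs) @ [Closing]"],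
        rule exI[of _ Opening], rule exI[of _ Closing]) simp
next
  case (subtree t t' ls rs)
  then obtain u v x y where "x \<noteq> y" "bracket_code t = u @ [x, y] @ v"
    "bracket_code t' = u @ [y, x] @ v"
    by blast
  \<comment> \<open>The code of a subtree is a contiguous factor of the whole code, so only the
    context \<open>u\<close>, \<open>v\<close> grows.\<close>
  then show ?case
    by (intro exI[of _ "Opening # concat (map bracket_code ls) @ u"]
        exI[of _ "v @ concat (map bracket_code rs) @ [Closing]"] exI[of _ x] exI[of _ y]) simp
qed

theorem proposition3p1:
  fixes T T' :: prtree
  assumes "transposition T T'"
  shows "even_prtree T \<noteq> even_prtree T'"
proof -
  obtain u v x y where "x \<noteq> y" and codes: "bracket_code T = u @ [x, y] @ v"
    "bracket_code T' = u @ [y, x] @ v"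
    using bracket_code_transposition[OF assms] by blast
  then consider "x = Closing" "y = Opening" | "x = Opening" "y = Closing"
    by (cases x; cases y) auto
  then show ?thesis
    by cases (simp_all only: even_prtree_def codes card_inversions_swap even_Suc, simp_all)
qed

end
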